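(* Let $\mathcal{G}=(G^{[1]},\dots,G^{[N]})$ be a finite time-evolving graph with positive edge weights, and fix one of the four backtracking regimes (i)–(iv), which determines the weighted global temporal transition matrix $M$. Let $Z=\operatorname{diag}(Z^{[1]},\dots,Z^{[N]})$ be the global weight matrix. Then for every integer $k\ge 1$, the $(e,f)$ entry of $\sqrt{Z}\,M^k\sqrt{Z}$ equals the sum, over all walks of length $k+1$ across $\mathcal{G}$ that start with edge $e$, end with edge $f$, and are permitted in the chosen regime, of the product of the weights of the edges of the walk.
   Context: All $G^{[\tau]}$ share the node set $\{1,\dots,n\}$, have no loops, and $G^{[\tau]}$ has $m_\tau$ directed edges with positive weights; edges of all time stamps are labelled jointly by $1,\dots,m$, $m=\sum_\tau m_\tau$, ordered by time stamp (an edge present at several time stamps gets a distinct label at each). $w_e$ is the weight of edge $e$ (at its time stamp). $L^{[\tau]},R^{[\tau]}\in\mathbb{R}^{m_\tau\times n}$ are the source/target matrices of $G^{[\tau]}$ ($L_{ej}=1$ iff edge $e$ starts at $j$; $R_{ej}=1$ iff $e$ ends at $j$), and $Z^{[\tau]}$ is the diagonal matrix of the weights of the edges of $G^{[\tau]}$. For $\tau_1,\tau_2$ set $W^{[\tau_1,\tau_2]}=Z^{[\tau_1]}R^{[\tau_1]}(L^{[\tau_2]})^TZ^{[\tau_2]}$, $W^{[\tau]}=W^{[\tau,\tau]}$, $B^{[\tau_1,\tau_2]}=W^{[\tau_1,\tau_2]}-(W^{[\tau_1,\tau_2]}\circ (W^{[\tau_2,\tau_1]})^T)^{\circ1/2}$,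 and $B^{[\tau]}$ the matrix with $B^{[\tau]}_{ef}=0$ if $W^{[\tau]}_{ef}W^{[\tau]}_{fe}\ne0$ and $B^{[\tau]}_{ef}=W^{[\tau]}_{ef}$ otherwise. $M$ is the $m\times m$ block upper triangular matrix $\bigl[\,C^{[\tau_1,\tau_2]}\,\bigr]^{\circ 1/2}$ (elementwise square root) with diagonal blocks $C^{[\tau,\tau]}=C^{[\tau]}$, blocks $C^{[\tau_1,\tau_2]}$ for $\tau_1<\tau_2$, and zero blocks below the diagonal, where: (i) backtracking in space and time permitted: $C^{[\tau]}=W^{[\tau]}$, $C^{[\tau_1,\tau_2]}=W^{[\tau_1,\tau_2]}$; (ii) space forbidden, time permitted: $C^{[\tau]}=B^{[\tau]}$, $C^{[\tau_1,\tau_2]}=W^{[\tau_1,\tau_2]}$; (iii) time forbidden, space permitted: $C^{[\tau]}=W^{[\tau]}$, $C^{[\tau_1,\tau_2]}=B^{[\tau_1,\tau_2]}$; (iv) both forbidden: $C^{[\tau]}=B^{[\tau]}$, $C^{[\tau_1,\tau_2]}=B^{[\tau_1,\tau_2]}$. A walk of length $\ell$ across $\mathcal{G}$ is a sequence of (labelled) edges $e_1,\dots,e_\ell$ with the end node of $e_k$ equal to the start node of $e_{k+1}$ and the time stamp of $e_k$ not exceeding that of $e_{k+1}$. A consecutive pair $e_k,e_{k+1}$ with $e_{k+1}$ the reversal of $e_k$ is backtracking in space if both have the same time stamp and backtracking in time if the time stamp strictly increases; a walk is permitted in a regime if it contains no consecutive pair of a forbidden kind. *)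

theory Defs
  imports "Jordan_Normal_Form.Matrix" Complex_Main
begin

text \<open>Nodes, time stamps and edge labels are numbered from \<open>0\<close>, in accordance with matrix indices.
  A snapshot lists its edges \<open>(source, target)\<close>; since the list is required to be distinct, it is
  an edge set together with a labelling of it by \<open>0, ..., m\<^sub>\<tau> - 1\<close>.\<close>

record snapshot =
  edges :: "(nat \<times> nat) list"
  weight :: "nat \<times> nat \<Rightarrow> real"

type_synonym temporal_graph = "snapshot list"

definition wf_snapshot :: "nat \<Rightarrow> snapshot \<Rightarrow> bool" where
  "wf_snapshot n g \<longleftrightarrow> distinct (edges g) \<and>
     (\<forall>(i, j) \<in> set (edges g). i < n \<and> j < n \<and> i \<noteq> j \<and> weight g (i, j) > 0)"

definition wf_temporal_graph :: "nat \<Rightarrow> temporal_graph \<Rightarrow> bool" where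
  "wf_temporal_graph n G \<longleftrightarrow> (\<forall>g \<in> set G. wf_snapshot n g)"

definition num_edges :: "temporal_graph \<Rightarrow> nat \<Rightarrow> nat" where
  "num_edges G \<tau> = length (edges (G ! \<tau>))"

definition total_edges :: "temporal_graph \<Rightarrow> nat" where
  "total_edges G = (\<Sum>\<tau><length G. num_edges G \<tau>)"

text \<open>Entry \<open>e\<close> of this list is the pair of the time stamp of the edge with joint label \<open>e\<close> and its
  label within its snapshot.\<close>

definition labels :: "temporal_graph \<Rightarrow> (nat \<times> nat) list" where
  "labels G = concat (map (\<lambda>\<tau>. map (Pair \<tau>) [0..<num_edges G \<tau>]) [0..<length G])"

lemma length_labels: "length (labels G) = total_edges G"
  by (simp add: labels_def total_edges_def length_concat comp_def interv_sum_list_conv_sum_set_nat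
      atLeast0LessThan)

definition stamp :: "temporal_graph \<Rightarrow> nat \<Rightarrow> nat" where
  "stamp G e = fst (labels G ! e)"

definition local_label :: "temporal_graph \<Rightarrow> nat \<Rightarrow> nat" where
  "local_label G e = snd (labels G ! e)"

definition edge :: "temporal_graph \<Rightarrow> nat \<Rightarrow> nat \<times> nat" where
  "edge G e = edges (G ! stamp G e) ! local_label G e"

definition edge_weight :: "temporal_graph \<Rightarrow> nat \<Rightarrow> real" where
  "edge_weight G e = weight (G ! stamp G e) (edge G e)"


definition source_mat :: "nat \<Rightarrow> temporal_graph \<Rightarrow> nat \<Rightarrow> real mat" where
  "source_mat n G \<tau> =
     mat (num_edges G \<tau>) n (\<lambda>(i, j). if fst (edges (G ! \<tau>) ! i) = j then 1 else 0)"

definition target_mat :: "nat \<Rightarrow> temporal_graph \<Rightarrow> nat \<Rightarrow> real mat" where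
  "target_mat n G \<tau> =
     mat (num_edges G \<tau>) n (\<lambda>(i, j). if snd (edges (G ! \<tau>) ! i) = j then 1 else 0)"

definition weight_mat :: "temporal_graph \<Rightarrow> nat \<Rightarrow> real mat" where
  "weight_mat G \<tau> = mat_diag (num_edges G \<tau>) (\<lambda>i. weight (G ! \<tau>) (edges (G ! \<tau>) ! i))"

definition global_weight_mat :: "temporal_graph \<Rightarrow> real mat" where
  "global_weight_mat G = diag_block_mat (map (weight_mat G) [0..<length G])"

definition hadamard :: "'a::times mat \<Rightarrow> 'a mat \<Rightarrow> 'a mat" where
  "hadamard A B = mat (dim_row A) (dim_col A) (\<lambda>(i, j). A $$ (i, j) * B $$ (i, j))"

definition W_mat :: "nat \<Rightarrow> temporal_graph \<Rightarrow> nat \<Rightarrow> nat \<Rightarrow> real mat" where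
  "W_mat n G \<tau>\<^sub>1 \<tau>\<^sub>2 =
     weight_mat G \<tau>\<^sub>1 * target_mat n G \<tau>\<^sub>1 * transpose_mat (source_mat n G \<tau>\<^sub>2) * weight_mat G \<tau>\<^sub>2"

definition B_time_mat :: "nat \<Rightarrow> temporal_graph \<Rightarrow> nat \<Rightarrow> nat \<Rightarrow> real mat" where
  "B_time_mat n G \<tau>\<^sub>1 \<tau>\<^sub>2 =
     W_mat n G \<tau>\<^sub>1 \<tau>\<^sub>2
       - map_mat sqrt (hadamard (W_mat n G \<tau>\<^sub>1 \<tau>\<^sub>2) (transpose_mat (W_mat n G \<tau>\<^sub>2 \<tau>\<^sub>1)))"

definition B_space_mat :: "nat \<Rightarrow> temporal_graph \<Rightarrow> nat \<Rightarrow> real mat" where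
  "B_space_mat n G \<tau> = mat (num_edges G \<tau>) (num_edges G \<tau>)
     (\<lambda>(e, f). if W_mat n G \<tau> \<tau> $$ (e, f) * W_mat n G \<tau> \<tau> $$ (f, e) \<noteq> 0 then 0
               else W_mat n G \<tau> \<tau> $$ (e, f))"


datatype regime = All_Permitted | Space_Forbidden | Time_Forbidden | Both_Forbidden

fun diag_block :: "regime \<Rightarrow> nat \<Rightarrow> temporal_graph \<Rightarrow> nat \<Rightarrow> real mat" where
  "diag_block All_Permitted n G \<tau> = W_mat n G \<tau> \<tau>"
| "diag_block Space_Forbidden n G \<tau> = B_space_mat n G \<tau>"
| "diag_block Time_Forbidden n G \<tau> = W_mat n G \<tau> \<tau>"
| "diag_block Both_Forbidden n G \<tau> = B_space_mat n G \<tau>"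

fun off_diag_block :: "regime \<Rightarrow> nat \<Rightarrow> temporal_graph \<Rightarrow> nat \<Rightarrow> nat \<Rightarrow> real mat" where
  "off_diag_block All_Permitted n G \<tau>\<^sub>1 \<tau>\<^sub>2 = W_mat n G \<tau>\<^sub>1 \<tau>\<^sub>2"
| "off_diag_block Space_Forbidden n G \<tau>\<^sub>1 \<tau>\<^sub>2 = W_mat n G \<tau>\<^sub>1 \<tau>\<^sub>2"
| "off_diag_block Time_Forbidden n G \<tau>\<^sub>1 \<tau>\<^sub>2 = B_time_mat n G \<tau>\<^sub>1 \<tau>\<^sub>2"
| "off_diag_block Both_Forbidden n G \<tau>\<^sub>1 \<tau>\<^sub>2 = B_time_mat n G \<tau>\<^sub>1 \<tau>\<^sub>2"

definition C_block :: "regime \<Rightarrow> nat \<Rightarrow> temporal_graph \<Rightarrow> nat \<Rightarrow> nat \<Rightarrow> real mat" where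
  "C_block r n G \<tau>\<^sub>1 \<tau>\<^sub>2 =
     (if \<tau>\<^sub>1 = \<tau>\<^sub>2 then diag_block r n G \<tau>\<^sub>1
      else if \<tau>\<^sub>1 < \<tau>\<^sub>2 then off_diag_block r n G \<tau>\<^sub>1 \<tau>\<^sub>2
      else 0\<^sub>m (num_edges G \<tau>\<^sub>1) (num_edges G \<tau>\<^sub>2))"

text \<open>The block matrix \<open>[A \<tau>\<^sub>1 \<tau>\<^sub>2]\<close>, where \<open>A \<tau>\<^sub>1 \<tau>\<^sub>2\<close> has dimension
  \<open>num_edges G \<tau>\<^sub>1 \<times> num_edges G \<tau>\<^sub>2\<close>.\<close>

definition block_mat :: "temporal_graph \<Rightarrow> (nat \<Rightarrow> nat \<Rightarrow> real mat) \<Rightarrow> real mat" where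
  "block_mat G A = mat (total_edges G) (total_edges G)
     (\<lambda>(e, f). A (stamp G e) (stamp G f) $$ (local_label G e, local_label G f))"

definition transition_mat :: "regime \<Rightarrow> nat \<Rightarrow> temporal_graph \<Rightarrow> real mat" where
  "transition_mat r n G = map_mat sqrt (block_mat G (C_block r n G))"


text \<open>Walks are lists of joint edge labels; their length is the number of edges.\<close>

definition is_walk :: "temporal_graph \<Rightarrow> nat list \<Rightarrow> bool" where
  "is_walk G es \<longleftrightarrow> set es \<subseteq> {..<total_edges G} \<and>
     (\<forall>k. Suc k < length es \<longrightarrow>
        snd (edge G (es ! k)) = fst (edge G (es ! Suc k)) \<and>
        stamp G (es ! k) \<le> stamp G (es ! Suc k))"

definition is_reversal :: "temporal_graph \<Rightarrow> nat \<Rightarrow> nat \<Rightarrow> bool" where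
  "is_reversal G e f \<longleftrightarrow> edge G f = prod.swap (edge G e)"

definition backtracks_in_space :: "temporal_graph \<Rightarrow> nat \<Rightarrow> nat \<Rightarrow> bool" where
  "backtracks_in_space G e f \<longleftrightarrow> is_reversal G e f \<and> stamp G e = stamp G f"

definition backtracks_in_time :: "temporal_graph \<Rightarrow> nat \<Rightarrow> nat \<Rightarrow> bool" where
  "backtracks_in_time G e f \<longleftrightarrow> is_reversal G e f \<and> stamp G e < stamp G f"

fun forbidden_pair :: "regime \<Rightarrow> temporal_graph \<Rightarrow> nat \<Rightarrow> nat \<Rightarrow> bool" where
  "forbidden_pair All_Permitted G e f \<longleftrightarrow> False"
| "forbidden_pair Space_Forbidden G e f \<longleftrightarrow> backtracks_in_space G e f"
| "forbidden_pair Time_Forbidden G e f \<longleftrightarrow> backtracks_in_time G e f"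
| "forbidden_pair Both_Forbidden G e f \<longleftrightarrow> backtracks_in_space G e f \<or> backtracks_in_time G e f"

definition permitted :: "regime \<Rightarrow> temporal_graph \<Rightarrow> nat list \<Rightarrow> bool" where
  "permitted r G es \<longleftrightarrow>
     (\<forall>k. Suc k < length es \<longrightarrow> \<not> forbidden_pair r G (es ! k) (es ! Suc k))"

definition permitted_walks :: "regime \<Rightarrow> temporal_graph \<Rightarrow> nat \<Rightarrow> nat \<Rightarrow> nat \<Rightarrow> nat list set" where
  "permitted_walks r G l e f =
     {es. is_walk G es \<and> length es = l \<and> es \<noteq> [] \<and> hd es = e \<and> last es = f \<and> permitted r G es}"

lemma finite_permitted_walks: "finite (permitted_walks r G l e f)"
  by (rule finite_subset[OF _ finite_lists_length_eq[of "{..<total_edges G}" l]])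
     (auto simp: permitted_walks_def is_walk_def)

end

theory Submission
  imports Defs
begin

text \<open>Elementwise, the transition matrix has entry \<open>sqrt w\<^sub>e * sqrt w\<^sub>f\<close> if \<open>f\<close> may follow \<open>e\<close> in
  the regime, and \<open>0\<close> otherwise. In a product of such entries along a walk, each interior edge
  contributes its weight and the two end edges contribute the square root of theirs; the factors
  \<open>sqrt Z\<close> on both sides supply the missing square roots.\<close>

definition may_follow :: "regime \<Rightarrow> temporal_graph \<Rightarrow> nat \<Rightarrow> nat \<Rightarrow> bool" where
  "may_follow r G e f \<longleftrightarrow> snd (edge G e) = fst (edge G f) \<and> stamp G e \<le> stamp G f \<and>
     \<not> forbidden_pair r G e f"

text \<open>Walk conditions and regime both constrain only consecutive pairs, so they merge into one
  relation. The form with \<open>successively\<close> splits along \<open>@\<close>, which the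
  induction on length relies on.\<close>

lemma permitted_walks_eq_successively:
  "permitted_walks r G l e f =
     {es. set es \<subseteq> {..<total_edges G} \<and> length es = l \<and> es \<noteq> [] \<and> hd es = e \<and> last es = f \<and>
        successively (may_follow r G) es}"
  by (auto simp: permitted_walks_def is_walk_def permitted_def successively_conv_nth may_follow_def)

lemma label_in_range:
  assumes "e < total_edges G"
  shows "stamp G e < length G" and "local_label G e < num_edges G (stamp G e)"
proof -
  have "labels G ! e \<in> set (labels G)"
    using assms by (simp add: length_labels)
  then show "stamp G e < length G" and "local_label G e < num_edges G (stamp G e)"
    by (auto simp: labels_def stamp_def local_label_def)
qed

lemma wf_edge:
  assumes "wf_temporal_graph n G" and "e < total_edges G"
  shows "fst (edge G e) < n" and "snd (edge G e) < n" and "edge_weight G e > 0"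
proof -
  have "wf_snapshot n (G ! stamp G e)"
    using assms label_in_range(1) by (auto simp: wf_temporal_graph_def)
  moreover have "edge G e \<in> set (edges (G ! stamp G e))"
    using label_in_range(2)[OF assms(2)] by (simp add: edge_def num_edges_def)
  ultimately show "fst (edge G e) < n" and "snd (edge G e) < n" and "edge_weight G e > 0"
    by (auto simp: wf_snapshot_def edge_weight_def)
qed

text \<open>Giving each diagonal as a list turns stacking of blocks into \<open>concat\<close>, so
  the index shift between blocks is just \<open>nth_append\<close>.\<close>

lemma diag_block_mat_mat_diag:
  "diag_block_mat (map (\<lambda>xs. mat_diag (length xs) ((!) xs)) xss) =
     mat_diag (length (concat xss)) ((!) (concat xss))"
proof (induction xss)
  case Nil
  then show ?case by (auto simp: mat_diag_def)
next
  case (Cons xs xss)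
  have "diag_block_mat (map (\<lambda>xs. mat_diag (length xs) ((!) xs)) (xs # xss)) =
      four_block_mat (mat_diag (length xs) ((!) xs)) (0\<^sub>m (length xs) (length (concat xss)))
        (0\<^sub>m (length (concat xss)) (length xs)) (mat_diag (length (concat xss)) ((!) (concat xss)))"
    \<comment> \<open>The induction hypothesis is applied before \<open>mat_diag\<close> is
      unfolded, while its left-hand side still matches.\<close>
    by (simp only: list.map diag_block_mat.simps Cons.IH Let_def) (simp add: mat_diag_def)
  then show ?case
    by (auto simp: mat_diag_def nth_append intro!: eq_matI)
qed

lemma global_weight_mat_eq_mat_diag:
  "global_weight_mat G = mat_diag (total_edges G) (edge_weight G)"
proof -
  define ws where
    "ws \<tau> = map (\<lambda>i. weight (G ! \<tau>) (edges (G ! \<tau>) ! i)) [0..<num_edges G \<tau>]" for \<tau>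
  have "weight_mat G = (\<lambda>\<tau>. mat_diag (length (ws \<tau>)) ((!) (ws \<tau>)))"
    by (rule ext, rule eq_matI) (auto simp: weight_mat_def mat_diag_def ws_def)
  then have "global_weight_mat G =
      mat_diag (length (concat (map ws [0..<length G]))) ((!) (concat (map ws [0..<length G])))"
    using diag_block_mat_mat_diag[of "map ws [0..<length G]"]
    by (simp add: global_weight_mat_def comp_def)
  \<comment> \<open>\<open>labels\<close> is itself a concatenation over the time stamps, so the
    joined weight lists follow the joint labelling.\<close>
  also have "concat (map ws [0..<length G]) =
      map (\<lambda>(\<tau>, i). weight (G ! \<tau>) (edges (G ! \<tau>) ! i)) (labels G)"
    by (simp add: labels_def map_concat ws_def[abs_def] comp_def)
  also have "mat_diag (length \<dots>) ((!) \<dots>) = mat_diag (total_edges G) (edge_weight G)"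
    by (rule eq_matI)
      (auto simp: mat_diag_def length_labels edge_weight_def edge_def stamp_def local_label_def
        split_beta)
  finally show ?thesis .
qed

lemma map_mat_mat_diag:
  assumes "h 0 = 0"
  shows "map_mat h (mat_diag m d) = mat_diag m (h \<circ> d)"
  by (rule eq_matI) (auto simp: mat_diag_def assms)

text \<open>Serves both sandwiches by diagonal matrices: the weights around \<open>R L^T\<close>
  inside \<open>W_mat\<close>, and the roots of the weights around the power of the transition
  matrix.\<close>

lemma mat_diag_mult_mat_diag_entry:
  assumes A: "A \<in> carrier_mat nr nc" and "i < nr" and "j < nc"
  shows "(mat_diag nr c * A * mat_diag nc d) $$ (i, j) = c i * A $$ (i, j) * d j"
proof -
  have cA: "mat_diag nr c * A = mat nr nc (\<lambda>(i, j). c i * A $$ (i, j))"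
    by (rule mat_diag_mult_left[OF A])
  then have "mat_diag nr c * A * mat_diag nc d =
      mat nr nc (\<lambda>(i, j). (mat_diag nr c * A) $$ (i, j) * d j)"
    by (intro mat_diag_mult_right) simp
  then show ?thesis
    using assms by (simp add: cA)
qed

lemma W_mat_dim [simp]:
  "dim_row (W_mat n G \<tau>\<^sub>1 \<tau>\<^sub>2) = num_edges G \<tau>\<^sub>1" "dim_col (W_mat n G \<tau>\<^sub>1 \<tau>\<^sub>2) = num_edges G \<tau>\<^sub>2"
  by (simp_all add: W_mat_def weight_mat_def mat_diag_def)

text \<open>The entry of \<open>R L^T\<close> counts the nodes that are both the end of
  \<open>e\<close> and the start of \<open>f\<close>, hence is 0 or 1; the outer factors attach the
  two weights.\<close>

lemma W_mat_entry:
  assumes "wf_temporal_graph n G" and e: "e < total_edges G" and f: "f < total_edges G"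
  shows "W_mat n G (stamp G e) (stamp G f) $$ (local_label G e, local_label G f) =
    (if snd (edge G e) = fst (edge G f) then edge_weight G e * edge_weight G f else 0)"
proof -
  let ?\<sigma> = "stamp G e" and ?\<tau> = "stamp G f" and ?i = "local_label G e" and ?j = "local_label G f"
  have ij: "?i < num_edges G ?\<sigma>" "?j < num_edges G ?\<tau>"
    using e f by (simp_all add: label_in_range)
  have dims: "weight_mat G \<tau> \<in> carrier_mat (num_edges G \<tau>) (num_edges G \<tau>)"
    "target_mat n G \<tau> \<in> carrier_mat (num_edges G \<tau>) n"
    "transpose_mat (source_mat n G \<tau>) \<in> carrier_mat n (num_edges G \<tau>)" for \<tau>
    by (simp_all add: weight_mat_def target_mat_def source_mat_def)
  have "W_mat n G ?\<sigma> ?\<tau> = weight_mat G ?\<sigma> *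
      (target_mat n G ?\<sigma> * transpose_mat (source_mat n G ?\<tau>)) * weight_mat G ?\<tau>"
    unfolding W_mat_def by (subst assoc_mult_mat[OF dims]) simp
  also have "\<dots> $$ (?i, ?j) = edge_weight G e *
      (target_mat n G ?\<sigma> * transpose_mat (source_mat n G ?\<tau>)) $$ (?i, ?j) * edge_weight G f"
    unfolding weight_mat_def
    by (simp add: mat_diag_mult_mat_diag_entry[OF mult_carrier_mat[OF dims(2,3)] ij]
        edge_weight_def edge_def)
  also have "(target_mat n G ?\<sigma> * transpose_mat (source_mat n G ?\<tau>)) $$ (?i, ?j) =
      (\<Sum>v<n. (if snd (edge G e) = v then 1 else 0) * (if fst (edge G f) = v then 1 else 0))"
    using ij by (simp add: target_mat_def source_mat_def scalar_prod_def edge_def atLeast0LessThan)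
  also have "\<dots> = (\<Sum>v<n. if snd (edge G e) = v then (if fst (edge G f) = v then 1 else 0) else 0)"
    by (rule sum.cong) auto
  \<comment> \<open>Only \<open>v = snd (edge G e)\<close> can contribute, and well-formedness puts
    it below \<open>n\<close>.\<close>
  also have "\<dots> = (if snd (edge G e) = fst (edge G f) then 1 else 0)"
    using wf_edge(2)[OF assms(1) e] by (auto simp: sum.delta')
  finally show ?thesis by simp
qed

text \<open>On a reversal both opposite \<open>W\<close> entries equal the product of the two
  positive weights, so the root of their product cancels the \<open>W\<close> entry exactly. On any
  other pair one of them is 0 and nothing is subtracted.\<close>

lemma B_time_mat_entry:
  assumes "wf_temporal_graph n G" and e: "e < total_edges G" and f: "f < total_edges G"
  shows "B_time_mat n G (stamp G e) (stamp G f) $$ (local_label G e, local_label G f) =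
    (if snd (edge G e) = fst (edge G f) \<and> \<not> is_reversal G e f
     then edge_weight G e * edge_weight G f else 0)"
  using label_in_range(2)[OF e] label_in_range(2)[OF f]
    wf_edge(3)[OF assms(1) e] wf_edge(3)[OF assms(1) f]
  by (auto simp: B_time_mat_def hadamard_def W_mat_entry[OF assms(1)] e f is_reversal_def
      prod_eq_iff mult.commute)

text \<open>As weights are positive, the two opposite \<open>W\<close> entries are both nonzero
  exactly when the edges are reversals of each other.\<close>

lemma B_space_mat_entry:
  assumes "wf_temporal_graph n G" and e: "e < total_edges G" and f: "f < total_edges G"
    and "stamp G e = stamp G f"
  shows "B_space_mat n G (stamp G e) $$ (local_label G e, local_label G f) =
    (if snd (edge G e) = fst (edge G f) \<and> \<not> is_reversal G e f
     then edge_weight G e * edge_weight G f else 0)"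
proof -
  let ?W = "W_mat n G (stamp G e) (stamp G e)"
  have "?W $$ (local_label G e, local_label G f) =
      (if snd (edge G e) = fst (edge G f) then edge_weight G e * edge_weight G f else 0)"
    "?W $$ (local_label G f, local_label G e) =
      (if snd (edge G f) = fst (edge G e) then edge_weight G f * edge_weight G e else 0)"
    using W_mat_entry[OF assms(1) e f] W_mat_entry[OF assms(1) f e] assms(4) by simp_all
  then show ?thesis
    using label_in_range(2)[OF e] label_in_range(2)[OF f]
      wf_edge(3)[OF assms(1) e] wf_edge(3)[OF assms(1) f] assms(4)
    by (auto simp: B_space_mat_def is_reversal_def prod_eq_iff)
qed

text \<open>Diagonal blocks can only meet backtracking in space and blocks above them only
  backtracking in time, so each block type enforces one prohibition. The zero blocks below encode
  that time stamps never decrease.\<close>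

lemma transition_mat_entry:
  assumes "wf_temporal_graph n G" and e: "e < total_edges G" and f: "f < total_edges G"
  shows "transition_mat r n G $$ (e, f) =
    (if may_follow r G e f then sqrt (edge_weight G e) * sqrt (edge_weight G f) else 0)"
proof -
  have "C_block r n G (stamp G e) (stamp G f) $$ (local_label G e, local_label G f) =
      (if may_follow r G e f then edge_weight G e * edge_weight G f else 0)"
  proof (cases "stamp G e" "stamp G f" rule: linorder_cases)
    case less
    then show ?thesis
      by (cases r) (simp_all add: C_block_def may_follow_def backtracks_in_space_def
          backtracks_in_time_def W_mat_entry[OF assms] B_time_mat_entry[OF assms])
  next
    case equal
    then show ?thesis
      using W_mat_entry[OF assms] B_space_mat_entry[OF assms equal]
      by (cases r) (simp_all add: C_block_def may_follow_def backtracks_in_space_def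
          backtracks_in_time_def)
  next
    case greater
    then show ?thesis
      using label_in_range(2)[OF e] label_in_range(2)[OF f]
      by (simp add: C_block_def may_follow_def)
  qed
  then show ?thesis
    using e f by (simp add: transition_mat_def block_mat_def real_sqrt_mult)
qed

lemma transition_mat_carrier:
  "transition_mat r n G \<in> carrier_mat (total_edges G) (total_edges G)"
  by (simp add: transition_mat_def block_mat_def)

text \<open>Classifies walks by their last edge but one; \<open>l > 0\<close> ensures that it
  exists.\<close>

lemma permitted_walks_Suc:
  assumes "l > 0" and "f < total_edges G"
  shows "permitted_walks r G (Suc l) e f =
    (\<Union>g\<in>{g. g < total_edges G \<and> may_follow r G g f}. (\<lambda>es. es @ [f]) ` permitted_walks r G l e g)"
    (is "?L = ?R")
proof (intro equalityI subsetI)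
  fix es assume "es \<in> ?L"
  then have es: "set es \<subseteq> {..<total_edges G}" "length es = Suc l" "es \<noteq> []" "hd es = e"
      "last es = f" "successively (may_follow r G) es"
    by (auto simp: permitted_walks_eq_successively)
  obtain xs where xs: "es = xs @ [f]"
    using es(3,5) append_butlast_last_id by metis
  with es assms have "xs \<noteq> []" by auto
  \<comment> \<open>\<open>last xs\<close> is the index \<open>g\<close> of the union to which
    \<open>es\<close> belongs.\<close>
  moreover from this have "last xs < total_edges G"
    using es(1) xs by (simp add: subset_eq)
  ultimately show "es \<in> ?R"
    using es xs by (auto simp: permitted_walks_eq_successively successively_append_iff)
next
  fix es assume "es \<in> ?R"
  then show "es \<in> ?L"
    using assms by (auto simp: permitted_walks_eq_successively successively_append_iff)
qed

text \<open>Keeping the outer square roots in the claim makes it hold from \<open>k = 0\<close>,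
  where the single walk \<open>[e]\<close> has weight \<open>sqrt w * sqrt w\<close>, and makes it
  reproduce itself in the induction.\<close>

lemma transition_mat_pow_entry:
  assumes wf: "wf_temporal_graph n G" and e: "e < total_edges G" and "f < total_edges G"
  shows "sqrt (edge_weight G e) * (transition_mat r n G ^\<^sub>m k) $$ (e, f) * sqrt (edge_weight G f) =
    (\<Sum>es \<in> permitted_walks r G (Suc k) e f. prod_list (map (edge_weight G) es))"
  using \<open>f < total_edges G\<close>
proof (induction k arbitrary: f)
  case 0
  have "permitted_walks r G (Suc 0) e f = (if e = f then {[e]} else {})"
    using e by (auto simp: permitted_walks_eq_successively length_Suc_conv)
  then show ?case
    using e 0 wf_edge(3)[OF wf e] transition_mat_carrier[of r n G] by auto
next
  case (Suc k)
  let ?M = "transition_mat r n G" and ?m = "total_edges G"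
  let ?w = "edge_weight G"
  let ?S = "\<lambda>l g. \<Sum>es \<in> permitted_walks r G l e g. prod_list (map (edge_weight G) es)"
  let ?F = "{g. g < ?m \<and> may_follow r G g f}"
  have pow: "?M ^\<^sub>m k \<in> carrier_mat ?m ?m"
    by (rule pow_carrier_mat[OF transition_mat_carrier])
  have "(?M ^\<^sub>m Suc k) $$ (e, f) = (\<Sum>g<?m. (?M ^\<^sub>m k) $$ (e, g) * ?M $$ (g, f))"
    using e Suc.prems pow transition_mat_carrier[of r n G]
    by (auto simp: scalar_prod_def atLeast0LessThan intro!: sum.cong)
  then have "sqrt (?w e) * (?M ^\<^sub>m Suc k) $$ (e, f) * sqrt (?w f) =
      (\<Sum>g<?m. sqrt (?w e) * ((?M ^\<^sub>m k) $$ (e, g) * ?M $$ (g, f)) * sqrt (?w f))"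
    by (simp only: sum_distrib_left sum_distrib_right)
  also have "\<dots> = (\<Sum>g<?m. if may_follow r G g f then ?S (Suc k) g * ?w f else 0)"
  proof (rule sum.cong)
    fix g assume "g \<in> {..<?m}"
    then show "sqrt (?w e) * ((?M ^\<^sub>m k) $$ (e, g) * ?M $$ (g, f)) * sqrt (?w f) =
        (if may_follow r G g f then ?S (Suc k) g * ?w f else 0)"
      \<comment> \<open>Of the two roots in the entry at \<open>(g, f)\<close>, that of
        \<open>g\<close> completes the left-hand side of the hypothesis for \<open>g\<close>, and
        that of \<open>f\<close> pairs with the outer one to give the full weight of
        \<open>f\<close>.\<close>
      using Suc wf_edge(3)[OF wf Suc.prems]
      by (simp add: transition_mat_entry[OF wf] flip: Suc.IH)
  qed simp
  also have "\<dots> = (\<Sum>g\<in>?F. ?S (Suc k) g * ?w f)"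
    by (subst sum.inter_filter[symmetric]) simp_all
  \<comment> \<open>Appending \<open>f\<close> is injective and multiplies the weight of a walk by
    that of \<open>f\<close>.\<close>
  also have "\<dots> = (\<Sum>g\<in>?F. \<Sum>es\<in>(\<lambda>es. es @ [f]) ` permitted_walks r G (Suc k) e g.
      prod_list (map ?w es))"
    by (simp add: sum.reindex inj_on_def sum_distrib_right)
  also have "\<dots> = ?S (Suc (Suc k)) f"
    unfolding permitted_walks_Suc[OF zero_less_Suc Suc.prems]
    \<comment> \<open>Disjointness: the prefix before \<open>f\<close> ends with \<open>g\<close>,
      so it determines \<open>g\<close>.\<close>
    by (rule sum.UNION_disjoint[symmetric])
      (auto simp: finite_permitted_walks, auto simp: permitted_walks_def)
  finally show ?case .
qed

theorem theorem5p5: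
  fixes n k e f :: nat and G :: temporal_graph and r :: regime
  assumes "wf_temporal_graph n G"
    and "k \<ge> 1"
    and "e < total_edges G" and "f < total_edges G"
  shows "(map_mat sqrt (global_weight_mat G) * (transition_mat r n G ^\<^sub>m k)
            * map_mat sqrt (global_weight_mat G)) $$ (e, f)
         = (\<Sum>es \<in> permitted_walks r G (k + 1) e f. prod_list (map (edge_weight G) es))"
proof -
  have "transition_mat r n G ^\<^sub>m k \<in> carrier_mat (total_edges G) (total_edges G)"
    by (rule pow_carrier_mat[OF transition_mat_carrier])
  then show ?thesis
    \<comment> \<open>Both outer factors become diagonal with the roots of the edge weights, leaving
      the scaled entry of the power.\<close>
    using assms
    by (simp add: global_weight_mat_eq_mat_diag map_mat_mat_diag mat_diag_mult_mat_diag_entry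
        transition_mat_pow_entry)
qed

end
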